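(* For all $\Phi\cup\{\psi\}\subseteq\mathcal L_{\Rrightarrow}$: if $\Phi\models\psi$ then $\Phi\vdash\psi$.
   Context: Fix a set $\mathcal P$ of atoms. Formulas of $\mathcal L_{\Rrightarrow}$: $\varphi ::= p \mid \bot \mid (\varphi\wedge\varphi)\mid(\varphi\to\varphi)\mid(\varphi\veebar\varphi)\mid(\varphi\Rrightarrow\varphi)$, $p\in\mathcal P$, with $\veebar$ inquisitive disjunction; $\neg\varphi:=\varphi\to\bot$, $\top:=\neg\bot$. A declarative is a formula in which every occurrence of $\veebar$ lies within an argument of some occurrence of $\Rrightarrow$. An in-model is $M=\langle W,\Sigma,V\rangle$ with $W$ nonempty, $\Sigma(w)$ a set of nonempty subsets of $W$ for each $w\in W$, $V:W\times\mathcal P\to\{0,1\}$. Support at $s\subseteq W$: $M,s\models p$ iff $V(w,p)=1$ for all $w\in s$; $M,s\models\bot$ iff $s=\emptyset$; $\wedge$ conjunctively; $M,s\models\varphi\veebar\psi$ iff $M,s\models\varphi$ or $M,s\models\psi$; $M,s\models\varphi\to\psi$ iff for all $t\subseteq s$, $M,t\models\varphi$ implies $M,t\models\psi$; $M,s\models\varphi\Rrightarrow\psi$ iff for all $w\in s$ and $t\in\Sigma(w)$, $M,t\models\varphi$ implies $M,t\models\psi$. $\Phi\models\psi$ means: for every in-model $M$ and state $s$, if $M,s\models\varphi$ for all $\varphi\in\Phi$ then $M,s\models\psi$. Proof system: axioms are all instances (in $\mathcal L_{\Rrightarrow}$) of the axioms of intuitionistic propositional logic with $\veebar$ as disjunction;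 (DDN) $\neg\neg\alpha\to\alpha$ and (Split) $(\alpha\to\varphi\veebar\psi)\to(\alpha\to\varphi)\veebar(\alpha\to\psi)$, for $\alpha$ declarative and $\varphi,\psi$ arbitrary; (Trans) $(\varphi\Rrightarrow\psi)\wedge(\psi\Rrightarrow\chi)\to(\varphi\Rrightarrow\chi)$; (RConj) $(\varphi\Rrightarrow\psi)\wedge(\varphi\Rrightarrow\chi)\to(\varphi\Rrightarrow\psi\wedge\chi)$; (LDisj) $(\varphi\Rrightarrow\chi)\wedge(\psi\Rrightarrow\chi)\to(\varphi\veebar\psi\Rrightarrow\chi)$. Rules: modus ponens (from $\varphi$ and $\varphi\to\psi$ infer $\psi$) and conditional necessitation (from $\varphi\to\psi$ infer $\varphi\Rrightarrow\psi$). $\Phi\vdash\psi$ means there are $\varphi_1,\dots,\varphi_n\in\Phi$ ($n\ge0$; empty conjunction is $\top$) such that $(\varphi_1\wedge\dots\wedge\varphi_n)\to\psi$ is derivable. *)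

theory Defs
  imports Main
begin

text \<open>
  The set of atoms is the type \<open>'p\<close>.  Object-language connectives are bold; \<open>\<^bold>\<or>\<close> is
  inquisitive disjunction.
\<close>

datatype 'p fm =
    Atom 'p
  | Bot  (\<open>\<^bold>\<bottom>\<close>)
  | And "'p fm" "'p fm"  (infixr \<open>\<^bold>\<and>\<close> 75)
  | IDisj "'p fm" "'p fm"  (infixr \<open>\<^bold>\<or>\<close> 70)
  | Imp "'p fm" "'p fm"  (infixr \<open>\<^bold>\<rightarrow>\<close> 65)
  | Cond "'p fm" "'p fm"  (infix \<open>\<Rrightarrow>\<close> 68)

abbreviation Neg :: "'p fm \<Rightarrow> 'p fm"  (\<open>\<^bold>\<not> _\<close> [80] 80)
  where "\<^bold>\<not> \<phi> \<equiv> \<phi> \<^bold>\<rightarrow> \<^bold>\<bottom>"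

abbreviation Top :: "'p fm"  (\<open>\<^bold>\<top>\<close>)
  where "\<^bold>\<top> \<equiv> \<^bold>\<not> \<^bold>\<bottom>"

primrec declarative :: "'p fm \<Rightarrow> bool" where
  "declarative (Atom p) \<longleftrightarrow> True"
| "declarative \<^bold>\<bottom> \<longleftrightarrow> True"
| "declarative (\<phi> \<^bold>\<and> \<psi>) \<longleftrightarrow> declarative \<phi> \<and> declarative \<psi>"
| "declarative (\<phi> \<^bold>\<or> \<psi>) \<longleftrightarrow> False"
| "declarative (\<phi> \<^bold>\<rightarrow> \<psi>) \<longleftrightarrow> declarative \<phi> \<and> declarative \<psi>"
| "declarative (\<phi> \<Rrightarrow> \<psi>) \<longleftrightarrow> True"

record ('w, 'p) in_struct =
  worlds :: "'w set"
  nbhd :: "'w \<Rightarrow> 'w set set"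
  val :: "'w \<Rightarrow> 'p \<Rightarrow> bool"

definition in_model :: "('w, 'p) in_struct \<Rightarrow> bool" where
  "in_model M \<longleftrightarrow>
     worlds M \<noteq> {} \<and>
     (\<forall>w \<in> worlds M. \<forall>t \<in> nbhd M w. t \<noteq> {} \<and> t \<subseteq> worlds M)"

primrec support :: "('w, 'p) in_struct \<Rightarrow> 'w set \<Rightarrow> 'p fm \<Rightarrow> bool" where
  "support M s (Atom p) \<longleftrightarrow> (\<forall>w \<in> s. val M w p)"
| "support M s \<^bold>\<bottom> \<longleftrightarrow> s = {}"
| "support M s (\<phi> \<^bold>\<and> \<psi>) \<longleftrightarrow> support M s \<phi> \<and> support M s \<psi>"
| "support M s (\<phi> \<^bold>\<or> \<psi>) \<longleftrightarrow> support M s \<phi> \<or> support M s \<psi>"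
| "support M s (\<phi> \<^bold>\<rightarrow> \<psi>) \<longleftrightarrow> (\<forall>t. t \<subseteq> s \<longrightarrow> support M t \<phi> \<longrightarrow> support M t \<psi>)"
| "support M s (\<phi> \<Rrightarrow> \<psi>) \<longleftrightarrow>
     (\<forall>w \<in> s. \<forall>t \<in> nbhd M w. support M t \<phi> \<longrightarrow> support M t \<psi>)"

text \<open>
  HOL cannot quantify over types inside a formula, so entailment is relative to a type \<open>'w\<close>
  from which the worlds are drawn; \<open>worlds M\<close> may be any nonempty set over that type.
  Entailment over all in-models whatsoever implies \<open>entails TYPE('w)\<close> for each \<open>'w\<close>, so
  completeness with respect to one particular \<open>'w\<close> implies completeness with respect to
  unrestricted entailment.
\<close>

definition entails :: "'w itself \<Rightarrow> 'p fm set \<Rightarrow> 'p fm \<Rightarrow> bool" where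
  "entails (_ :: 'w itself) \<Phi> \<psi> \<longleftrightarrow>
     (\<forall>(M :: ('w, 'p) in_struct) s.
        in_model M \<longrightarrow> s \<subseteq> worlds M \<longrightarrow> (\<forall>\<phi> \<in> \<Phi>. support M s \<phi>) \<longrightarrow> support M s \<psi>)"

inductive derivable :: "'p fm \<Rightarrow> bool" where
  ImpK: "derivable (\<phi> \<^bold>\<rightarrow> \<psi> \<^bold>\<rightarrow> \<phi>)"
| ImpS: "derivable ((\<phi> \<^bold>\<rightarrow> \<psi> \<^bold>\<rightarrow> \<chi>) \<^bold>\<rightarrow> (\<phi> \<^bold>\<rightarrow> \<psi>) \<^bold>\<rightarrow> \<phi> \<^bold>\<rightarrow> \<chi>)"
| AndE1: "derivable (\<phi> \<^bold>\<and> \<psi> \<^bold>\<rightarrow> \<phi>)"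
| AndE2: "derivable (\<phi> \<^bold>\<and> \<psi> \<^bold>\<rightarrow> \<psi>)"
| AndI: "derivable (\<phi> \<^bold>\<rightarrow> \<psi> \<^bold>\<rightarrow> \<phi> \<^bold>\<and> \<psi>)"
| IDisjI1: "derivable (\<phi> \<^bold>\<rightarrow> \<phi> \<^bold>\<or> \<psi>)"
| IDisjI2: "derivable (\<psi> \<^bold>\<rightarrow> \<phi> \<^bold>\<or> \<psi>)"
| IDisjE: "derivable ((\<phi> \<^bold>\<rightarrow> \<chi>) \<^bold>\<rightarrow> (\<psi> \<^bold>\<rightarrow> \<chi>) \<^bold>\<rightarrow> (\<phi> \<^bold>\<or> \<psi> \<^bold>\<rightarrow> \<chi>))"
| BotE: "derivable (\<^bold>\<bottom> \<^bold>\<rightarrow> \<phi>)"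
| DDN: "declarative \<alpha> \<Longrightarrow> derivable (\<^bold>\<not> \<^bold>\<not> \<alpha> \<^bold>\<rightarrow> \<alpha>)"
| Split: "declarative \<alpha> \<Longrightarrow>
    derivable ((\<alpha> \<^bold>\<rightarrow> (\<phi> \<^bold>\<or> \<psi>)) \<^bold>\<rightarrow> ((\<alpha> \<^bold>\<rightarrow> \<phi>) \<^bold>\<or> (\<alpha> \<^bold>\<rightarrow> \<psi>)))"
| Trans: "derivable ((\<phi> \<Rrightarrow> \<psi>) \<^bold>\<and> (\<psi> \<Rrightarrow> \<chi>) \<^bold>\<rightarrow> (\<phi> \<Rrightarrow> \<chi>))"
| RConj: "derivable ((\<phi> \<Rrightarrow> \<psi>) \<^bold>\<and> (\<phi> \<Rrightarrow> \<chi>) \<^bold>\<rightarrow> (\<phi> \<Rrightarrow> (\<psi> \<^bold>\<and> \<chi>)))"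
| LDisj: "derivable ((\<phi> \<Rrightarrow> \<chi>) \<^bold>\<and> (\<psi> \<Rrightarrow> \<chi>) \<^bold>\<rightarrow> ((\<phi> \<^bold>\<or> \<psi>) \<Rrightarrow> \<chi>))"
| MP: "derivable \<phi> \<Longrightarrow> derivable (\<phi> \<^bold>\<rightarrow> \<psi>) \<Longrightarrow> derivable \<psi>"
| CNec: "derivable (\<phi> \<^bold>\<rightarrow> \<psi>) \<Longrightarrow> derivable (\<phi> \<Rrightarrow> \<psi>)"

fun conj_list :: "'p fm list \<Rightarrow> 'p fm" where
  "conj_list [] = \<^bold>\<top>"
| "conj_list [\<phi>] = \<phi>"
| "conj_list (\<phi> # \<phi>' # \<phi>s) = \<phi> \<^bold>\<and> conj_list (\<phi>' # \<phi>s)"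

definition derives :: "'p fm set \<Rightarrow> 'p fm \<Rightarrow> bool"  (infix \<open>\<^bold>\<turnstile>\<close> 50) where
  "\<Phi> \<^bold>\<turnstile> \<psi> \<longleftrightarrow> (\<exists>\<phi>s. set \<phi>s \<subseteq> \<Phi> \<and> derivable (conj_list \<phi>s \<^bold>\<rightarrow> \<psi>))"

end

theory Submission
  imports Defs
begin

text \<open>
  The proof is a canonical model construction.  Worlds are the consistent prime theories that
  decide every formula.  A prime theory \<open>T\<close> is represented by the state of all worlds extending
  it: by (Split) membership in \<open>T\<close> reduces to membership of one of finitely many declarative
  resolutions, and by (DDN) a declarative belongs to \<open>T\<close> iff it belongs to all those worlds.
  The neighbourhoods of \<open>w\<close> are the nonempty states respecting every \<open>\<phi> \<Rrightarrow> \<psi> \<in> w\<close>.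
  By (Trans), (RConj), (LDisj) and necessitation, \<open>\<lambda>\<phi> \<psi>. \<phi> \<Rrightarrow> \<psi> \<in> w\<close> is a distributive lattice
  preorder, so the prime filter theorem separates \<open>\<phi>\<close> from \<open>\<psi>\<close> whenever \<open>\<phi> \<Rrightarrow> \<psi> \<notin> w\<close>, and the
  resulting prime theory yields the neighbourhood that refutes \<open>\<phi> \<Rrightarrow> \<psi>\<close> at \<open>w\<close>.
\<close>

section \<open>Theories\<close>

text \<open>Closure under \<open>CNec\<close> is not imposed: the consequences of an added
  assumption must again form a theory, and necessitation applies to derivable implications
  alone.\<close>

definition is_theory :: "'p fm set \<Rightarrow> bool" where
  "is_theory T \<longleftrightarrow>
     (\<forall>\<phi>. derivable \<phi> \<longrightarrow> \<phi> \<in> T) \<and> (\<forall>\<phi> \<psi>. \<phi> \<in> T \<longrightarrow> \<phi> \<^bold>\<rightarrow> \<psi> \<in> T \<longrightarrow> \<psi> \<in> T)"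

lemma theory_derivable: "is_theory T \<Longrightarrow> derivable \<phi> \<Longrightarrow> \<phi> \<in> T"
  by (simp add: is_theory_def)

lemma theory_mp: "is_theory T \<Longrightarrow> \<phi> \<^bold>\<rightarrow> \<psi> \<in> T \<Longrightarrow> \<phi> \<in> T \<Longrightarrow> \<psi> \<in> T"
  unfolding is_theory_def by blast

lemma theory_mp_subset:
  "\<phi> \<^bold>\<rightarrow> \<psi> \<in> T \<Longrightarrow> is_theory U \<Longrightarrow> T \<subseteq> U \<Longrightarrow> \<phi> \<in> U \<Longrightarrow> \<psi> \<in> U"
  using theory_mp by blast

lemma theory_closed: "is_theory T \<Longrightarrow> derivable (\<phi> \<^bold>\<rightarrow> \<psi>) \<Longrightarrow> \<phi> \<in> T \<Longrightarrow> \<psi> \<in> T"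
  using theory_derivable theory_mp by blast

lemma theory_Collect_derivable: "is_theory {\<phi>. derivable \<phi>}"
  by (auto simp: is_theory_def intro: MP)

lemma theory_Inter: "(\<And>T. T \<in> \<T> \<Longrightarrow> is_theory T) \<Longrightarrow> is_theory (\<Inter>\<T>)"
  unfolding is_theory_def by blast

lemma theory_weaken: "is_theory T \<Longrightarrow> \<psi> \<in> T \<Longrightarrow> \<phi> \<^bold>\<rightarrow> \<psi> \<in> T"
  using theory_closed[OF _ ImpK] .

lemma derivable_refl: "derivable (\<phi> \<^bold>\<rightarrow> \<phi>)"
  using MP[OF ImpK MP[OF ImpK ImpS]] .

text \<open>This is the deduction theorem: \<open>ImpS\<close> gives closure under modus ponens, and
  \<open>ImpK\<close> supplies the derivable formulas.\<close>

lemma theory_adjoin: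
  assumes "is_theory T"
  shows "is_theory {\<psi>. \<phi> \<^bold>\<rightarrow> \<psi> \<in> T}"
proof -
  have "\<phi> \<^bold>\<rightarrow> \<chi> \<in> T" if "\<phi> \<^bold>\<rightarrow> \<psi> \<in> T" "\<phi> \<^bold>\<rightarrow> \<psi> \<^bold>\<rightarrow> \<chi> \<in> T" for \<psi> \<chi>
    using theory_mp[OF assms theory_closed[OF assms ImpS that(2)] that(1)] .
  moreover have "\<phi> \<^bold>\<rightarrow> \<psi> \<in> T" if "derivable \<psi>" for \<psi>
    using theory_weaken[OF assms theory_derivable[OF assms that]] .
  ultimately show ?thesis
    unfolding is_theory_def by blast
qed

text \<open>It suffices to take for \<open>U\<close> the consequences of \<phi> over
  \<open>T\<close>. Implications can thus be proved as in a Kripke model whose points are theories,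
  without writing Hilbert derivations.\<close>

lemma theory_impI:
  assumes "is_theory T"
    and "\<And>U. is_theory U \<Longrightarrow> T \<subseteq> U \<Longrightarrow> \<phi> \<in> U \<Longrightarrow> \<psi> \<in> U"
  shows "\<phi> \<^bold>\<rightarrow> \<psi> \<in> T"
proof -
  have "\<psi> \<in> {\<psi>. \<phi> \<^bold>\<rightarrow> \<psi> \<in> T}"
    using theory_adjoin[OF assms(1)] theory_weaken[OF assms(1)]
      theory_derivable[OF assms(1) derivable_refl]
    by (intro assms(2)) auto
  then show ?thesis by simp
qed

text \<open>The derivable formulas form the least theory, so \<open>theory_impI\<close> applies to
  them.\<close>

lemma derivable_impI:
  assumes "\<And>T. is_theory T \<Longrightarrow> \<phi> \<in> T \<Longrightarrow> \<psi> \<in> T"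
  shows "derivable (\<phi> \<^bold>\<rightarrow> \<psi>)"
  using theory_impI[OF theory_Collect_derivable, of \<phi> \<psi>] assms by simp

section \<open>Connectives inside theories\<close>

lemma theory_conj: "is_theory T \<Longrightarrow> \<phi> \<^bold>\<and> \<psi> \<in> T \<longleftrightarrow> \<phi> \<in> T \<and> \<psi> \<in> T"
  by (meson AndE1 AndE2 AndI theory_closed theory_mp)

lemma theory_disjI:
  assumes "is_theory T" "\<phi> \<in> T \<or> \<psi> \<in> T"
  shows "\<phi> \<^bold>\<or> \<psi> \<in> T"
  using assms IDisjI1 IDisjI2 theory_closed by blast

lemma theory_disjE:
  assumes T: "is_theory T" and "\<phi> \<^bold>\<or> \<psi> \<in> T"
    and "\<And>U. is_theory U \<Longrightarrow> T \<subseteq> U \<Longrightarrow> \<phi> \<in> U \<Longrightarrow> \<chi> \<in> U"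
    and "\<And>U. is_theory U \<Longrightarrow> T \<subseteq> U \<Longrightarrow> \<psi> \<in> U \<Longrightarrow> \<chi> \<in> U"
  shows "\<chi> \<in> T"
proof -
  have "\<phi> \<^bold>\<rightarrow> \<chi> \<in> T" "\<psi> \<^bold>\<rightarrow> \<chi> \<in> T"
    using theory_impI[OF T] assms(3,4) by blast+
  then show ?thesis
    using theory_mp[OF T theory_mp[OF T theory_closed[OF T IDisjE]] assms(2)] by blast
qed

lemma theory_botE: "is_theory T \<Longrightarrow> \<^bold>\<bottom> \<in> T \<Longrightarrow> \<phi> \<in> T"
  using theory_closed[OF _ BotE] .

lemma derivable_distrib: "derivable (\<phi> \<^bold>\<and> (\<psi> \<^bold>\<or> \<chi>) \<^bold>\<rightarrow> (\<phi> \<^bold>\<and> \<psi>) \<^bold>\<or> (\<phi> \<^bold>\<and> \<chi>))"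
proof (rule derivable_impI)
  fix T :: "'a fm set"
  assume T: "is_theory T" and "\<phi> \<^bold>\<and> (\<psi> \<^bold>\<or> \<chi>) \<in> T"
  then have "\<phi> \<in> T" "\<psi> \<^bold>\<or> \<chi> \<in> T" by (simp_all add: theory_conj)
  then show "(\<phi> \<^bold>\<and> \<psi>) \<^bold>\<or> (\<phi> \<^bold>\<and> \<chi>) \<in> T"
    by (elim theory_disjE[OF T]) (auto simp: theory_conj intro!: theory_disjI)
qed

text \<open>Intuitionistically valid, hence available also when \<psi> is not declarative. The
  premise \<phi> gives it the shape of an inequality in the double-negation preorder used to build
  worlds.\<close>

lemma derivable_nn_excluded_middle: "derivable (\<phi> \<^bold>\<rightarrow> \<^bold>\<not> \<^bold>\<not> (\<psi> \<^bold>\<or> \<^bold>\<not> \<psi>))"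
proof (intro derivable_impI theory_impI)
  fix T U :: "'a fm set"
  assume U: "is_theory U" and n: "\<^bold>\<not> (\<psi> \<^bold>\<or> \<^bold>\<not> \<psi>) \<in> U"
  have "\<^bold>\<not> \<psi> \<in> U"
    by (rule theory_impI[OF U], rule theory_mp_subset[OF n]) (simp_all add: theory_disjI)
  then show "\<^bold>\<bottom> \<in> U"
    by (simp add: theory_mp[OF U n] theory_disjI[OF U])
qed

section \<open>Prime filters\<close>

definition prime_theory :: "'p fm set \<Rightarrow> bool" where
  "prime_theory T \<longleftrightarrow> is_theory T \<and> (\<forall>\<phi> \<psi>. \<phi> \<^bold>\<or> \<psi> \<in> T \<longrightarrow> \<phi> \<in> T \<or> \<psi> \<in> T)"

lemma prime_theoryD: "prime_theory T \<Longrightarrow> is_theory T"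
  by (simp add: prime_theory_def)

lemma prime_theory_disj: "prime_theory T \<Longrightarrow> \<phi> \<^bold>\<or> \<psi> \<in> T \<longleftrightarrow> \<phi> \<in> T \<or> \<psi> \<in> T"
  using prime_theory_def theory_disjI by blast

text \<open>One prime filter argument serves three preorders: implication in a theory, implication
  up to double negation, and \<Rrightarrow> at a world. Reflexivity, the projections and
  distributivity all come from \<open>le_derivable\<close>.\<close>

locale lattice_preorder =
  fixes le :: "'p fm \<Rightarrow> 'p fm \<Rightarrow> bool"
  assumes le_derivable: "derivable (\<phi> \<^bold>\<rightarrow> \<psi>) \<Longrightarrow> le \<phi> \<psi>"
    and le_trans: "le \<phi> \<psi> \<Longrightarrow> le \<psi> \<chi> \<Longrightarrow> le \<phi> \<chi>"
    and le_conj: "le \<phi> \<psi> \<Longrightarrow> le \<phi> \<chi> \<Longrightarrow> le \<phi> (\<psi> \<^bold>\<and> \<chi>)"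
    and le_disj: "le \<phi> \<chi> \<Longrightarrow> le \<psi> \<chi> \<Longrightarrow> le (\<phi> \<^bold>\<or> \<psi>) \<chi>"
begin

text \<open>The empty set counts as a filter; where an element matters, it is assumed
  separately.\<close>

definition is_filter :: "'p fm set \<Rightarrow> bool" where
  "is_filter F \<longleftrightarrow>
     (\<forall>\<phi> \<psi>. \<phi> \<in> F \<longrightarrow> le \<phi> \<psi> \<longrightarrow> \<psi> \<in> F) \<and> (\<forall>\<phi> \<psi>. \<phi> \<in> F \<longrightarrow> \<psi> \<in> F \<longrightarrow> \<phi> \<^bold>\<and> \<psi> \<in> F)"

lemma filter_up: "is_filter F \<Longrightarrow> \<phi> \<in> F \<Longrightarrow> le \<phi> \<psi> \<Longrightarrow> \<psi> \<in> F"
  unfolding is_filter_def by blast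

lemma filter_conj: "is_filter F \<Longrightarrow> \<phi> \<in> F \<Longrightarrow> \<psi> \<in> F \<Longrightarrow> \<phi> \<^bold>\<and> \<psi> \<in> F"
  unfolding is_filter_def by blast

lemma le_conj1: "le (\<phi> \<^bold>\<and> \<psi>) \<phi>" and le_conj2: "le (\<phi> \<^bold>\<and> \<psi>) \<psi>"
  by (simp_all add: le_derivable AndE1 AndE2)

lemma le_conj_mono: "le \<phi> \<phi>' \<Longrightarrow> le \<psi> \<psi>' \<Longrightarrow> le (\<phi> \<^bold>\<and> \<psi>) (\<phi>' \<^bold>\<and> \<psi>')"
  by (meson le_conj le_conj1 le_conj2 le_trans)

lemma le_refl: "le \<phi> \<phi>"
  by (simp add: le_derivable derivable_refl)

lemma filter_principal: "is_filter {\<psi>. le \<phi> \<psi>}"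
  unfolding is_filter_def using le_conj le_trans by blast

text \<open>For nonempty \<open>F\<close> this is the filter generated by \<open>F\<close> and
  \<chi>. Two witnesses from \<open>F\<close> are merged into their conjunction.\<close>

lemma filter_adjoin:
  assumes F: "is_filter F"
  shows "is_filter {\<psi>. \<exists>\<gamma> \<in> F. le (\<gamma> \<^bold>\<and> \<chi>) \<psi>}"
proof -
  have "\<exists>\<gamma> \<in> F. le (\<gamma> \<^bold>\<and> \<chi>) (\<phi> \<^bold>\<and> \<psi>)"
    if "\<gamma>1 \<in> F" "le (\<gamma>1 \<^bold>\<and> \<chi>) \<phi>" "\<gamma>2 \<in> F" "le (\<gamma>2 \<^bold>\<and> \<chi>) \<psi>" for \<gamma>1 \<gamma>2 \<phi> \<psi>
  proof (intro bexI le_conj)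
    show "\<gamma>1 \<^bold>\<and> \<gamma>2 \<in> F" using filter_conj[OF F] that by blast
    show "le ((\<gamma>1 \<^bold>\<and> \<gamma>2) \<^bold>\<and> \<chi>) \<phi>"
      using le_trans[OF le_conj_mono[OF le_conj1 le_refl] that(2)] .
    show "le ((\<gamma>1 \<^bold>\<and> \<gamma>2) \<^bold>\<and> \<chi>) \<psi>"
      using le_trans[OF le_conj_mono[OF le_conj2 le_refl] that(4)] .
  qed
  moreover have "\<exists>\<gamma> \<in> F. le (\<gamma> \<^bold>\<and> \<chi>) \<psi>" if "\<gamma> \<in> F" "le (\<gamma> \<^bold>\<and> \<chi>) \<phi>" "le \<phi> \<psi>" for \<gamma> \<phi> \<psi>
    using that(1) le_trans[OF that(2,3)] by blast
  ultimately show ?thesis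
    unfolding is_filter_def by blast
qed

lemma filter_chain_Union:
  assumes "subset.chain {F. is_filter F} \<C>"
  shows "is_filter (\<Union>\<C>)"
proof -
  have filter: "is_filter F" if "F \<in> \<C>" for F
    using assms that unfolding subset_chain_def by blast
  show ?thesis
    unfolding is_filter_def
  proof (intro conjI allI impI)
    fix \<phi> \<psi> assume "\<phi> \<in> \<Union>\<C>" "le \<phi> \<psi>"
    then show "\<psi> \<in> \<Union>\<C>"
      using filter filter_up by blast
  next
    fix \<phi> \<psi> assume "\<phi> \<in> \<Union>\<C>" "\<psi> \<in> \<Union>\<C>"
    then obtain F G where "F \<in> \<C>" "\<phi> \<in> F" "G \<in> \<C>" "\<psi> \<in> G"
      by blast
    moreover from this have "F \<subseteq> G \<or> G \<subseteq> F"
      using assms unfolding subset_chain_def by blast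
    ultimately obtain H where "H \<in> \<C>" "\<phi> \<in> H" "\<psi> \<in> H"
      by blast
    then show "\<phi> \<^bold>\<and> \<psi> \<in> \<Union>\<C>"
      using filter_conj[OF filter] by blast
  qed
qed

text \<open>A derivable formula is implied by \<alpha>, and modus ponens is the derivable passage
  from \<phi> and \<phi> \<rightarrow> \<psi>, taken in conjunction, to \<psi>.\<close>

lemma filter_theory:
  assumes F: "is_filter F" and "\<alpha> \<in> F"
  shows "is_theory F"
  unfolding is_theory_def
proof (intro conjI allI impI)
  fix \<phi> :: "'p fm" assume "derivable \<phi>"
  then show "\<phi> \<in> F"
    using filter_up[OF F \<open>\<alpha> \<in> F\<close>] le_derivable[OF MP[OF _ ImpK]] by blast
next
  fix \<phi> \<psi> assume "\<phi> \<in> F" "\<phi> \<^bold>\<rightarrow> \<psi> \<in> F"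
  then have "\<phi> \<^bold>\<and> (\<phi> \<^bold>\<rightarrow> \<psi>) \<in> F" by (rule filter_conj[OF F])
  moreover have "derivable (\<phi> \<^bold>\<and> (\<phi> \<^bold>\<rightarrow> \<psi>) \<^bold>\<rightarrow> \<psi>)"
    by (rule derivable_impI) (auto simp: theory_conj intro: theory_mp)
  ultimately show "\<psi> \<in> F"
    using filter_up[OF F] le_derivable by blast
qed

text \<open>By Zorn's lemma there is a maximal filter among those containing \<alpha> and omitting
  \<beta>; maximality together with distributivity makes it prime.\<close>

theorem prime_filter_separation:
  assumes "\<not> le \<alpha> \<beta>"
  obtains T where "prime_theory T" "\<alpha> \<in> T" "\<beta> \<notin> T"
    "\<And>\<phi> \<psi>. \<phi> \<in> T \<Longrightarrow> le \<phi> \<psi> \<Longrightarrow> \<psi> \<in> T"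
proof -
  let ?A = "{F. is_filter F \<and> \<alpha> \<in> F \<and> \<beta> \<notin> F}"
  have "{\<psi>. le \<alpha> \<psi>} \<in> ?A"
    using assms filter_principal le_refl by simp
  moreover have "\<Union>\<C> \<in> ?A" if "\<C> \<noteq> {}" "subset.chain ?A \<C>" for \<C>
  proof -
    have "subset.chain {F. is_filter F} \<C>"
      using that(2) unfolding subset_chain_def by blast
    then have "is_filter (\<Union>\<C>)"
      by (rule filter_chain_Union)
    moreover have "\<C> \<subseteq> ?A"
      using that(2) unfolding subset_chain_def by blast
    ultimately show ?thesis
      using that(1) by blast
  qed
  ultimately have "\<exists>T \<in> ?A. \<forall>F \<in> ?A. T \<subseteq> F \<longrightarrow> F = T"
    by (intro subset_Zorn_nonempty) blast+
  then obtain T where T: "T \<in> ?A" and max: "\<And>F. F \<in> ?A \<Longrightarrow> T \<subseteq> F \<Longrightarrow> F = T"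
    by blast
  have fT: "is_filter T" and "\<alpha> \<in> T" "\<beta> \<notin> T"
    using T by auto
  \<comment> \<open>By maximality, adjoining any formula outside \<open>T\<close> must produce
    \<beta>.\<close>
  have adjoin: "\<exists>\<gamma> \<in> T. le (\<gamma> \<^bold>\<and> \<chi>) \<beta>" if "\<chi> \<notin> T" for \<chi>
  proof (rule ccontr)
    let ?F = "{\<psi>. \<exists>\<gamma> \<in> T. le (\<gamma> \<^bold>\<and> \<chi>) \<psi>}"
    assume "\<not> ?thesis"
    then have "\<beta> \<notin> ?F" by simp
    moreover have sub: "T \<subseteq> ?F" and "\<chi> \<in> ?F"
      using le_conj1 le_conj2 \<open>\<alpha> \<in> T\<close> by blast+
    moreover have "\<alpha> \<in> ?F"
      using sub \<open>\<alpha> \<in> T\<close> by (rule subsetD)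
    ultimately have "?F = T"
      using filter_adjoin[OF fT, of \<chi>] by (intro max) simp_all
    then show False
      using \<open>\<chi> \<in> ?F\<close> that by simp
  qed
  have "\<phi> \<in> T \<or> \<psi> \<in> T" if d: "\<phi> \<^bold>\<or> \<psi> \<in> T" for \<phi> \<psi>
  proof (rule ccontr)
    assume "\<not> ?thesis"
    then obtain \<gamma>1 \<gamma>2 where g: "\<gamma>1 \<in> T" "le (\<gamma>1 \<^bold>\<and> \<phi>) \<beta>" "\<gamma>2 \<in> T" "le (\<gamma>2 \<^bold>\<and> \<psi>) \<beta>"
      using adjoin by blast
    \<comment> \<open>A common witness for both disjuncts lets distributivity and
      \<open>le_disj\<close> combine the two cases, forcing \<beta> into \<open>T\<close>.\<close>
    let ?g = "\<gamma>1 \<^bold>\<and> \<gamma>2"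
    have "le (?g \<^bold>\<and> \<phi>) \<beta>" "le (?g \<^bold>\<and> \<psi>) \<beta>"
      using le_trans[OF le_conj_mono[OF le_conj1 le_refl] g(2)]
        le_trans[OF le_conj_mono[OF le_conj2 le_refl] g(4)] .
    then have "le (?g \<^bold>\<and> (\<phi> \<^bold>\<or> \<psi>)) \<beta>"
      by (rule le_trans[OF le_derivable[OF derivable_distrib] le_disj])
    moreover have "?g \<^bold>\<and> (\<phi> \<^bold>\<or> \<psi>) \<in> T"
      by (intro filter_conj[OF fT] g(1,3) d)
    ultimately show False
      using filter_up[OF fT] \<open>\<beta> \<notin> T\<close> by blast
  qed
  then have "prime_theory T"
    unfolding prime_theory_def using filter_theory[OF fT \<open>\<alpha> \<in> T\<close>] by blast
  then show thesis
    using that \<open>\<alpha> \<in> T\<close> \<open>\<beta> \<notin> T\<close> filter_up[OF fT] by blast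
qed

end

lemma prime_extension:
  assumes T: "is_theory T" and "\<phi> \<^bold>\<rightarrow> \<psi> \<notin> T"
  obtains U where "prime_theory U" "T \<subseteq> U" "\<phi> \<in> U" "\<psi> \<notin> U"
proof -
  interpret lattice_preorder "\<lambda>\<phi> \<psi>. \<phi> \<^bold>\<rightarrow> \<psi> \<in> T"
  proof
    fix \<phi> \<psi> :: "'a fm" assume "derivable (\<phi> \<^bold>\<rightarrow> \<psi>)"
    then show "\<phi> \<^bold>\<rightarrow> \<psi> \<in> T" by (rule theory_derivable[OF T])
  next
    fix \<phi> \<psi> \<chi> assume "\<phi> \<^bold>\<rightarrow> \<psi> \<in> T" "\<psi> \<^bold>\<rightarrow> \<chi> \<in> T"
    then show "\<phi> \<^bold>\<rightarrow> \<chi> \<in> T"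
      using theory_mp_subset[of _ _ T] by (intro theory_impI[OF T]) blast
  next
    fix \<phi> \<psi> \<chi> assume "\<phi> \<^bold>\<rightarrow> \<psi> \<in> T" "\<phi> \<^bold>\<rightarrow> \<chi> \<in> T"
    then show "\<phi> \<^bold>\<rightarrow> \<psi> \<^bold>\<and> \<chi> \<in> T"
      using theory_mp_subset[of _ _ T] by (intro theory_impI[OF T]) (simp add: theory_conj)
  next
    fix \<phi> \<psi> \<chi> assume "\<phi> \<^bold>\<rightarrow> \<chi> \<in> T" "\<psi> \<^bold>\<rightarrow> \<chi> \<in> T"
    then show "\<phi> \<^bold>\<or> \<psi> \<^bold>\<rightarrow> \<chi> \<in> T"
      by (rule theory_mp[OF T theory_closed[OF T IDisjE]])
  qed
  obtain U where U: "prime_theory U" "\<phi> \<in> U" "\<psi> \<notin> U"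
    "\<And>\<phi> \<psi>. \<phi> \<in> U \<Longrightarrow> \<phi> \<^bold>\<rightarrow> \<psi> \<in> T \<Longrightarrow> \<psi> \<in> U"
    using prime_filter_separation[OF assms(2)] by blast
  \<comment> \<open>In this preorder every formula lies below each member of \<open>T\<close>, so
    upward closure from \<phi> suffices.\<close>
  moreover have "T \<subseteq> U"
    using U(2,4) theory_weaken[OF T] by blast
  ultimately show thesis
    using that by blast
qed

section \<open>Resolutions\<close>

text \<open>Each entry encodes one way of choosing a \<beta> for every \<alpha>, as the conjunction
  of the implications \<alpha> \<rightarrow> \<beta>; verum is the empty conjunction.\<close>

fun imp_resolutions :: "'p fm list \<Rightarrow> 'p fm list \<Rightarrow> 'p fm list" where
  "imp_resolutions [] \<beta>s = [\<^bold>\<top>]"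
| "imp_resolutions (\<alpha> # \<alpha>s) \<beta>s = [(\<alpha> \<^bold>\<rightarrow> \<beta>) \<^bold>\<and> \<gamma>. \<beta> \<leftarrow> \<beta>s, \<gamma> \<leftarrow> imp_resolutions \<alpha>s \<beta>s]"

text \<open>A conditional is declarative whatever its arguments, so it is its own sole
  resolution.\<close>

primrec resolutions :: "'p fm \<Rightarrow> 'p fm list" where
  "resolutions (Atom p) = [Atom p]"
| "resolutions \<^bold>\<bottom> = [\<^bold>\<bottom>]"
| "resolutions (\<phi> \<^bold>\<and> \<psi>) = [\<alpha> \<^bold>\<and> \<beta>. \<alpha> \<leftarrow> resolutions \<phi>, \<beta> \<leftarrow> resolutions \<psi>]"
| "resolutions (\<phi> \<^bold>\<or> \<psi>) = resolutions \<phi> @ resolutions \<psi>"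
| "resolutions (\<phi> \<^bold>\<rightarrow> \<psi>) = imp_resolutions (resolutions \<phi>) (resolutions \<psi>)"
| "resolutions (\<phi> \<Rrightarrow> \<psi>) = [\<phi> \<Rrightarrow> \<psi>]"

abbreviation resolved_in :: "'p fm \<Rightarrow> 'p fm set \<Rightarrow> bool" where
  "resolved_in \<phi> T \<equiv> \<exists>\<rho> \<in> set (resolutions \<phi>). \<rho> \<in> T"

lemma declarative_imp_resolutions:
  assumes "\<forall>\<alpha> \<in> set \<alpha>s. declarative \<alpha>" "\<forall>\<beta> \<in> set \<beta>s. declarative \<beta>"
  shows "\<forall>\<gamma> \<in> set (imp_resolutions \<alpha>s \<beta>s). declarative \<gamma>"
  using assms by (induction \<alpha>s) auto

lemma declarative_resolutions: "\<rho> \<in> set (resolutions \<phi>) \<Longrightarrow> declarative \<rho>"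
proof (induction \<phi> arbitrary: \<rho>)
  case (Imp \<phi> \<psi>)
  then show ?case
    using declarative_imp_resolutions[of "resolutions \<phi>" "resolutions \<psi>"] by auto
qed auto

text \<open>A conjunction is in \<open>T\<close> iff its conjuncts are, so the choices for the
  individual \<alpha> are independent.\<close>

lemma theory_imp_resolutions:
  assumes T: "is_theory T"
  shows "(\<exists>\<gamma> \<in> set (imp_resolutions \<alpha>s \<beta>s). \<gamma> \<in> T) \<longleftrightarrow>
    (\<forall>\<alpha> \<in> set \<alpha>s. \<exists>\<beta> \<in> set \<beta>s. \<alpha> \<^bold>\<rightarrow> \<beta> \<in> T)"
proof (induction \<alpha>s)
  case Nil
  then show ?case using theory_derivable[OF T derivable_refl] by simp
next
  case (Cons \<alpha> \<alpha>s)
  have "(\<exists>\<gamma> \<in> set (imp_resolutions (\<alpha> # \<alpha>s) \<beta>s). \<gamma> \<in> T) \<longleftrightarrow>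
    (\<exists>\<beta> \<in> set \<beta>s. \<alpha> \<^bold>\<rightarrow> \<beta> \<in> T) \<and> (\<exists>\<gamma> \<in> set (imp_resolutions \<alpha>s \<beta>s). \<gamma> \<in> T)"
    by (auto simp: theory_conj[OF T])
  then show ?case using Cons.IH by simp
qed

lemma resolved_in_conj:
  "is_theory T \<Longrightarrow> resolved_in (\<phi> \<^bold>\<and> \<psi>) T \<longleftrightarrow> resolved_in \<phi> T \<and> resolved_in \<psi> T"
  by (auto simp: theory_conj)

lemma resolved_in_imp:
  "is_theory T \<Longrightarrow> resolved_in (\<phi> \<^bold>\<rightarrow> \<psi>) T \<longleftrightarrow>
    (\<forall>\<alpha> \<in> set (resolutions \<phi>). \<exists>\<beta> \<in> set (resolutions \<psi>). \<alpha> \<^bold>\<rightarrow> \<beta> \<in> T)"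
  by (simp add: theory_imp_resolutions)

text \<open>(Split) is exactly primeness of the set of consequences of \<alpha> over
  \<open>T\<close>.\<close>

lemma prime_theory_adjoin_declarative:
  assumes T: "prime_theory T" and "declarative \<alpha>"
  shows "prime_theory {\<psi>. \<alpha> \<^bold>\<rightarrow> \<psi> \<in> T}"
proof -
  have "\<alpha> \<^bold>\<rightarrow> \<phi> \<in> T \<or> \<alpha> \<^bold>\<rightarrow> \<psi> \<in> T" if "\<alpha> \<^bold>\<rightarrow> \<phi> \<^bold>\<or> \<psi> \<in> T" for \<phi> \<psi>
    using theory_closed[OF prime_theoryD[OF T] Split[OF assms(2)] that] prime_theory_disj[OF T]
    by simp
  then show ?thesis
    unfolding prime_theory_def using theory_adjoin[OF prime_theoryD[OF T]] by simp
qed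

text \<open>Induction for all prime theories at once, since the implication case passes to other
  ones: adjoining a resolution of the antecedent in one direction, a prime extension refuting the
  implication in the other.\<close>

lemma prime_theory_resolved_in:
  assumes "prime_theory T"
  shows "\<phi> \<in> T \<longleftrightarrow> resolved_in \<phi> T"
  using assms
proof (induction \<phi> arbitrary: T)
  case (And \<phi> \<psi>)
  then show ?case
    by (simp only: resolved_in_conj theory_conj prime_theoryD)
next
  case (IDisj \<phi> \<psi>)
  then show ?case
    by (auto simp: prime_theory_disj)
next
  case (Imp \<phi> \<psi>)
  note T = prime_theoryD[OF Imp.prems]
  show ?case
  proof
    assume imp: "\<phi> \<^bold>\<rightarrow> \<psi> \<in> T"
    show "resolved_in (\<phi> \<^bold>\<rightarrow> \<psi>) T"
      unfolding resolved_in_imp[OF T]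
    proof
      fix \<alpha> assume \<alpha>: "\<alpha> \<in> set (resolutions \<phi>)"
      let ?U = "{\<psi>. \<alpha> \<^bold>\<rightarrow> \<psi> \<in> T}"
      have U: "prime_theory ?U"
        using prime_theory_adjoin_declarative[OF Imp.prems declarative_resolutions[OF \<alpha>]] .
      have "\<alpha> \<in> ?U"
        using theory_derivable[OF T derivable_refl] by simp
      then have "\<phi> \<in> ?U"
        using Imp.IH(1)[OF U] \<alpha> by blast
      moreover have "\<phi> \<^bold>\<rightarrow> \<psi> \<in> ?U"
        using theory_weaken[OF T imp] by simp
      ultimately have "\<psi> \<in> ?U"
        using theory_mp[OF prime_theoryD[OF U], of \<phi> \<psi>] by blast
      then show "\<exists>\<beta> \<in> set (resolutions \<psi>). \<alpha> \<^bold>\<rightarrow> \<beta> \<in> T"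
        using Imp.IH(2)[OF U] by simp
    qed
  next
    assume res: "resolved_in (\<phi> \<^bold>\<rightarrow> \<psi>) T"
    show "\<phi> \<^bold>\<rightarrow> \<psi> \<in> T"
    proof (rule ccontr)
      assume "\<phi> \<^bold>\<rightarrow> \<psi> \<notin> T"
      then obtain U where U: "prime_theory U" "T \<subseteq> U" "\<phi> \<in> U" "\<psi> \<notin> U"
        using prime_extension[OF T] by blast
      then obtain \<alpha> where \<alpha>: "\<alpha> \<in> set (resolutions \<phi>)" "\<alpha> \<in> U"
        using Imp.IH(1) by blast
      then obtain \<beta> where "\<beta> \<in> set (resolutions \<psi>)" "\<alpha> \<^bold>\<rightarrow> \<beta> \<in> U"
        using res U(2) unfolding resolved_in_imp[OF T] by blast
      then show False
        using U(4) Imp.IH(2)[OF U(1)] theory_mp[OF prime_theoryD[OF U(1)] _ \<alpha>(2)] by blast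
    qed
  qed
qed auto

section \<open>The canonical model\<close>

text \<open>These are the maximal consistent theories. A world plays the part of a singleton state,
  on which inquisitive disjunction is classical.\<close>

definition canonical_worlds :: "'p fm set set" where
  "canonical_worlds =
     {w. prime_theory w \<and> \<^bold>\<bottom> \<notin> w \<and> (\<forall>\<phi>. \<phi> \<in> w \<or> \<^bold>\<not> \<phi> \<in> w)}"

text \<open>\<open>resolved_in\<close> stands in for support, which cannot be mentioned before the
  model exists. Admitting every compatible state makes one half of the support lemma for
  \<Rrightarrow> true by definition.\<close>

definition canonical_nbhd :: "'p fm set \<Rightarrow> 'p fm set set set" where
  "canonical_nbhd w =
     {s. s \<noteq> {} \<and> s \<subseteq> canonical_worlds \<and>
         (\<forall>\<phi> \<psi>. \<phi> \<Rrightarrow> \<psi> \<in> w \<longrightarrow> resolved_in \<phi> (\<Inter>s) \<longrightarrow> resolved_in \<psi> (\<Inter>s))}"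

definition canonical_model :: "('p fm set, 'p) in_struct" where
  "canonical_model =
     \<lparr>worlds = canonical_worlds, nbhd = canonical_nbhd, val = (\<lambda>w p. Atom p \<in> w)\<rparr>"

definition theory_state :: "'p fm set \<Rightarrow> 'p fm set set" where
  "theory_state T = {w \<in> canonical_worlds. T \<subseteq> w}"

section \<open>Worlds and the states of theories\<close>

lemma canonical_world_theory: "w \<in> canonical_worlds \<Longrightarrow> is_theory w"
  by (simp add: canonical_worlds_def prime_theoryD)

lemma canonical_world_imp:
  assumes "w \<in> canonical_worlds"
  shows "\<phi> \<^bold>\<rightarrow> \<psi> \<in> w \<longleftrightarrow> (\<phi> \<in> w \<longrightarrow> \<psi> \<in> w)"
proof
  note w = canonical_world_theory[OF assms]
  show "\<phi> \<in> w \<longrightarrow> \<psi> \<in> w" if "\<phi> \<^bold>\<rightarrow> \<psi> \<in> w"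
    using theory_mp[OF w that] by blast
  assume "\<phi> \<in> w \<longrightarrow> \<psi> \<in> w"
  moreover have "\<phi> \<^bold>\<rightarrow> \<psi> \<in> w" if "\<^bold>\<not> \<phi> \<in> w"
    by (rule theory_impI[OF w], rule theory_botE) (auto intro: theory_mp_subset[OF that])
  ultimately show "\<phi> \<^bold>\<rightarrow> \<psi> \<in> w"
    using assms theory_weaken[OF w] unfolding canonical_worlds_def by blast
qed

text \<open>
  Prime filters of the double-negation preorder below contain excluded middle for every formula;
  (DDN) ensures that this preorder does not make the declarative \<open>\<alpha>\<close> a top element.
\<close>

lemma canonical_world_extension:
  assumes T: "is_theory T" and "declarative \<alpha>" "\<alpha> \<notin> T"
  obtains w where "w \<in> canonical_worlds" "T \<subseteq> w" "\<alpha> \<notin> w"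
proof -
  interpret lattice_preorder "\<lambda>\<phi> \<psi>. \<phi> \<^bold>\<rightarrow> \<^bold>\<not> \<^bold>\<not> \<psi> \<in> T"
  proof
    fix \<phi> \<psi> :: "'a fm" assume "derivable (\<phi> \<^bold>\<rightarrow> \<psi>)"
    then show "\<phi> \<^bold>\<rightarrow> \<^bold>\<not> \<^bold>\<not> \<psi> \<in> T"
      by (intro theory_impI[OF T] theory_impI) (auto intro: theory_mp theory_closed)
  next
    fix \<phi> \<psi> \<chi> assume a: "\<phi> \<^bold>\<rightarrow> \<^bold>\<not> \<^bold>\<not> \<psi> \<in> T" "\<psi> \<^bold>\<rightarrow> \<^bold>\<not> \<^bold>\<not> \<chi> \<in> T"
    show "\<phi> \<^bold>\<rightarrow> \<^bold>\<not> \<^bold>\<not> \<chi> \<in> T"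
    proof (intro theory_impI[OF T] theory_impI)
      fix U V assume U: "is_theory U" "T \<subseteq> U" "\<phi> \<in> U"
        and V: "is_theory V" "U \<subseteq> V" "\<^bold>\<not> \<chi> \<in> V"
      \<comment> \<open>Contraposition: the refutation of \<chi> in \<open>V\<close> is pulled back
        to one of \<psi>, against the double negation of \<psi>.\<close>
      have "\<^bold>\<not> \<psi> \<in> V"
      proof (rule theory_impI[OF V(1)])
        fix X assume X: "is_theory X" "V \<subseteq> X" "\<psi> \<in> X"
        have "\<^bold>\<not> \<^bold>\<not> \<chi> \<in> X"
          using theory_mp_subset[OF a(2) X(1)] U(2) V(2) X(2,3) by blast
        then show "\<^bold>\<bottom> \<in> X"
          using theory_mp[OF X(1)] V(3) X(2) by blast
      qed
      moreover have "\<^bold>\<not> \<^bold>\<not> \<psi> \<in> V"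
        using theory_mp_subset[OF a(1) U] V(2) by blast
      ultimately show "\<^bold>\<bottom> \<in> V"
        using theory_mp[OF V(1)] by blast
    qed
  next
    fix \<phi> \<psi> \<chi> assume a: "\<phi> \<^bold>\<rightarrow> \<^bold>\<not> \<^bold>\<not> \<psi> \<in> T" "\<phi> \<^bold>\<rightarrow> \<^bold>\<not> \<^bold>\<not> \<chi> \<in> T"
    show "\<phi> \<^bold>\<rightarrow> \<^bold>\<not> \<^bold>\<not> (\<psi> \<^bold>\<and> \<chi>) \<in> T"
    proof (intro theory_impI[OF T] theory_impI)
      fix U V assume U: "is_theory U" "T \<subseteq> U" "\<phi> \<in> U"
        and V: "is_theory V" "U \<subseteq> V" "\<^bold>\<not> (\<psi> \<^bold>\<and> \<chi>) \<in> V"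
      have "\<^bold>\<not> \<^bold>\<not> \<psi> \<in> V" and nnc: "\<^bold>\<not> \<^bold>\<not> \<chi> \<in> V"
        using theory_mp_subset[OF a(1) U] theory_mp_subset[OF a(2) U] V(2) by blast+
      \<comment> \<open>If \<psi> held, the negated conjunction would refute \<chi>, against its
        double negation.\<close>
      moreover have "\<^bold>\<not> \<psi> \<in> V"
      proof (rule theory_impI[OF V(1)])
        fix X assume X: "is_theory X" "V \<subseteq> X" "\<psi> \<in> X"
        have "\<^bold>\<not> \<chi> \<in> X"
          using X by (intro theory_impI[OF X(1)] theory_mp_subset[OF V(3)]) (auto simp: theory_conj)
        then show "\<^bold>\<bottom> \<in> X"
          using theory_mp_subset[OF nnc X(1,2)] by blast
      qed
      ultimately show "\<^bold>\<bottom> \<in> V"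
        using theory_mp[OF V(1)] by blast
    qed
  next
    fix \<phi> \<psi> \<chi> assume "\<phi> \<^bold>\<rightarrow> \<^bold>\<not> \<^bold>\<not> \<chi> \<in> T" "\<psi> \<^bold>\<rightarrow> \<^bold>\<not> \<^bold>\<not> \<chi> \<in> T"
    then show "\<phi> \<^bold>\<or> \<psi> \<^bold>\<rightarrow> \<^bold>\<not> \<^bold>\<not> \<chi> \<in> T"
      by (rule theory_mp[OF T theory_closed[OF T IDisjE]])
  qed
  have "\<^bold>\<top> \<^bold>\<rightarrow> \<^bold>\<not> \<^bold>\<not> \<alpha> \<notin> T"
    using theory_mp[OF T _ theory_derivable[OF T derivable_refl]]
      theory_closed[OF T DDN[OF assms(2)]] assms(3) by blast
  then obtain w where w: "prime_theory w" "\<^bold>\<top> \<in> w" "\<alpha> \<notin> w"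
    and up: "\<And>\<phi> \<psi>. \<phi> \<in> w \<Longrightarrow> \<phi> \<^bold>\<rightarrow> \<^bold>\<not> \<^bold>\<not> \<psi> \<in> T \<Longrightarrow> \<psi> \<in> w"
    using prime_filter_separation by blast
  have "T \<subseteq> w"
  proof
    fix \<phi> assume "\<phi> \<in> T"
    then have "\<^bold>\<top> \<^bold>\<rightarrow> \<^bold>\<not> \<^bold>\<not> \<phi> \<in> T"
      by (intro theory_weaken[OF T] theory_impI[OF T]) (auto intro: theory_mp)
    then show "\<phi> \<in> w"
      using up w(2) by blast
  qed
  moreover have "\<phi> \<in> w \<or> \<^bold>\<not> \<phi> \<in> w" for \<phi>
  proof -
    \<comment> \<open>Excluded middle lies above verum in this preorder; primeness of
      \<open>w\<close> then decides \<phi>.\<close>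
    have "\<phi> \<^bold>\<or> \<^bold>\<not> \<phi> \<in> w"
      using up[OF w(2)] theory_derivable[OF T derivable_nn_excluded_middle] by blast
    then show ?thesis
      using prime_theory_disj[OF w(1)] by blast
  qed
  moreover have "\<^bold>\<bottom> \<notin> w"
    using w(1,3) prime_theoryD theory_botE by blast
  ultimately show thesis
    using that w unfolding canonical_worlds_def by blast
qed

text \<open>A declarative outside \<open>T\<close> is omitted by some world above \<open>T\<close>.
  Non-declaratives can behave differently: excluded middle holds in every world but need not belong
  to \<open>T\<close>.\<close>

lemma Inter_theory_state:
  assumes "is_theory T" "declarative \<alpha>"
  shows "\<alpha> \<in> \<Inter>(theory_state T) \<longleftrightarrow> \<alpha> \<in> T"
proof
  assume *: "\<alpha> \<in> \<Inter>(theory_state T)"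
  show "\<alpha> \<in> T"
  proof (rule ccontr)
    assume "\<alpha> \<notin> T"
    then obtain w where "w \<in> theory_state T" "\<alpha> \<notin> w"
      unfolding theory_state_def using canonical_world_extension[OF assms] by blast
    then show False using * by blast
  qed
qed (auto simp: theory_state_def)

text \<open>Resolutions are declarative, so \<open>T\<close> and the intersection contain the same
  ones, and a prime theory is determined by its resolutions.\<close>

lemma resolved_in_theory_state:
  assumes "prime_theory T"
  shows "resolved_in \<phi> (\<Inter>(theory_state T)) \<longleftrightarrow> \<phi> \<in> T"
proof -
  have "\<rho> \<in> \<Inter>(theory_state T) \<longleftrightarrow> \<rho> \<in> T" if "\<rho> \<in> set (resolutions \<phi>)" for \<rho>
    using Inter_theory_state[OF prime_theoryD[OF assms] declarative_resolutions[OF that]] .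
  then show ?thesis
    using prime_theory_resolved_in[OF assms, of \<phi>] by (simp cong: bex_cong)
qed

text \<open>The intersection over the empty state is the universal set; falsum, being declarative,
  would then lie in \<open>T\<close>.\<close>

lemma theory_state_nonempty:
  assumes "is_theory T" "\<phi> \<notin> T"
  shows "theory_state T \<noteq> {}"
proof -
  have "\<^bold>\<bottom> \<notin> T" using assms theory_botE by blast
  then show ?thesis
    using Inter_theory_state[OF assms(1), of "\<^bold>\<bottom>"] by auto
qed

text \<open>This is the hard half of the support lemma for \<Rrightarrow>; (Trans), (RConj), (LDisj)
  and \<open>CNec\<close> verify the locale axioms.\<close>

lemma canonical_nbhd_refuting:
  assumes "w \<in> canonical_worlds" "\<phi> \<Rrightarrow> \<psi> \<notin> w"
  obtains s where "s \<in> canonical_nbhd w" "resolved_in \<phi> (\<Inter>s)" "\<not> resolved_in \<psi> (\<Inter>s)"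
proof -
  note w = canonical_world_theory[OF assms(1)]
  interpret lattice_preorder "\<lambda>\<phi> \<psi>. \<phi> \<Rrightarrow> \<psi> \<in> w"
  proof
    fix \<phi> \<psi> :: "'a fm" assume "derivable (\<phi> \<^bold>\<rightarrow> \<psi>)"
    then show "\<phi> \<Rrightarrow> \<psi> \<in> w" by (rule theory_derivable[OF w CNec])
  next
    fix \<phi> \<psi> \<chi> assume "\<phi> \<Rrightarrow> \<psi> \<in> w" "\<psi> \<Rrightarrow> \<chi> \<in> w"
    then show "\<phi> \<Rrightarrow> \<chi> \<in> w"
      using theory_closed[OF w Trans[of \<phi> \<psi> \<chi>]] theory_conj[OF w] by simp
  next
    fix \<phi> \<psi> \<chi> assume "\<phi> \<Rrightarrow> \<psi> \<in> w" "\<phi> \<Rrightarrow> \<chi> \<in> w"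
    then show "\<phi> \<Rrightarrow> (\<psi> \<^bold>\<and> \<chi>) \<in> w"
      using theory_closed[OF w RConj[of \<phi> \<psi> \<chi>]] theory_conj[OF w] by simp
  next
    fix \<phi> \<psi> \<chi> assume "\<phi> \<Rrightarrow> \<chi> \<in> w" "\<psi> \<Rrightarrow> \<chi> \<in> w"
    then show "(\<phi> \<^bold>\<or> \<psi>) \<Rrightarrow> \<chi> \<in> w"
      using theory_closed[OF w LDisj[of \<phi> \<chi> \<psi>]] theory_conj[OF w] by simp
  qed
  obtain T where T: "prime_theory T" "\<phi> \<in> T" "\<psi> \<notin> T"
    "\<And>\<phi> \<psi>. \<phi> \<in> T \<Longrightarrow> \<phi> \<Rrightarrow> \<psi> \<in> w \<Longrightarrow> \<psi> \<in> T"
    using prime_filter_separation[OF assms(2)] by blast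
  \<comment> \<open>Closure of \<open>T\<close> under the conditionals in \<open>w\<close> is the
    compatibility condition, read through \<open>resolved_in_theory_state\<close>; omission of
    \<psi> gives nonemptiness.\<close>
  have "theory_state T \<in> canonical_nbhd w"
    unfolding canonical_nbhd_def mem_Collect_eq resolved_in_theory_state[OF T(1)]
    using theory_state_nonempty[OF prime_theoryD[OF T(1)] T(3)] T(4)
    by (auto simp: theory_state_def)
  then show thesis
    by (rule that) (simp_all only: resolved_in_theory_state[OF T(1)] T(2,3) not_False_eq_True)
qed

text \<open>The truth lemma, for all states: implication passes to substates and \<Rrightarrow> to
  neighbourhoods. For the empty state the intersection is the universal set, matching support of
  every formula.\<close>

lemma canonical_support:
  assumes "s \<subseteq> canonical_worlds"
  shows "support canonical_model s \<phi> \<longleftrightarrow> resolved_in \<phi> (\<Inter>s)"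
  using assms
proof (induction \<phi> arbitrary: s)
  case (Atom p)
  then show ?case by (simp add: canonical_model_def)
next
  case Bot
  then have "\<^bold>\<bottom> \<notin> w" if "w \<in> s" for w
    using that by (auto simp: canonical_worlds_def)
  then show ?case by auto
next
  case (And \<phi> \<psi>)
  have "is_theory (\<Inter>s)"
    using canonical_world_theory[OF subsetD[OF And.prems]] by (rule theory_Inter)
  then show ?case
    using And by (simp only: support.simps resolved_in_conj)
next
  case (IDisj \<phi> \<psi>)
  then show ?case by (simp add: bex_Un)
next
  case (Imp \<phi> \<psi>)
  have "is_theory (\<Inter>s)"
    using canonical_world_theory[OF subsetD[OF Imp.prems]] by (rule theory_Inter)
  note res = resolved_in_imp[OF this]
  have IH: "support canonical_model t \<phi> \<longleftrightarrow> resolved_in \<phi> (\<Inter>t)"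
    "support canonical_model t \<psi> \<longleftrightarrow> resolved_in \<psi> (\<Inter>t)" if "t \<subseteq> s" for t
    using Imp.IH[OF subset_trans[OF that Imp.prems]] .
  have imp: "\<alpha> \<^bold>\<rightarrow> \<beta> \<in> \<Inter>s \<longleftrightarrow> (\<forall>w \<in> s. \<alpha> \<in> w \<longrightarrow> \<beta> \<in> w)" for \<alpha> \<beta>
    using canonical_world_imp[OF subsetD[OF Imp.prems]] by simp
  show ?case
    unfolding res imp support.simps
  proof (intro iffI ballI allI impI)
    fix \<alpha> assume *: "\<forall>t \<subseteq> s. support canonical_model t \<phi> \<longrightarrow> support canonical_model t \<psi>"
      and \<alpha>: "\<alpha> \<in> set (resolutions \<phi>)"
    \<comment> \<open>The largest substate of \<open>s\<close> supporting \<alpha>; a resolution of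
      \<psi> throughout it is the required \<beta>.\<close>
    define t where "t = {w \<in> s. \<alpha> \<in> w}"
    have t: "t \<subseteq> s" and "\<alpha> \<in> \<Inter>t"
      by (auto simp: t_def)
    then have "support canonical_model t \<phi>"
      using IH(1)[OF t] \<alpha> by blast
    then have "support canonical_model t \<psi>"
      using * t by simp
    then obtain \<beta> where "\<beta> \<in> set (resolutions \<psi>)" "\<beta> \<in> \<Inter>t"
      using IH(2)[OF t] by blast
    then show "\<exists>\<beta> \<in> set (resolutions \<psi>). \<forall>w \<in> s. \<alpha> \<in> w \<longrightarrow> \<beta> \<in> w"
      unfolding t_def by blast
  next
    fix t assume *: "\<forall>\<alpha> \<in> set (resolutions \<phi>). \<exists>\<beta> \<in> set (resolutions \<psi>). \<forall>w \<in> s. \<alpha> \<in> w \<longrightarrow> \<beta> \<in> w"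
      and t: "t \<subseteq> s" and supp: "support canonical_model t \<phi>"
    obtain \<alpha> where \<alpha>: "\<alpha> \<in> set (resolutions \<phi>)" "\<alpha> \<in> \<Inter>t"
      using supp IH(1)[OF t] by blast
    obtain \<beta> where \<beta>: "\<beta> \<in> set (resolutions \<psi>)" "\<forall>w \<in> s. \<alpha> \<in> w \<longrightarrow> \<beta> \<in> w"
      using * \<alpha>(1) by blast
    have "\<beta> \<in> \<Inter>t"
      using \<alpha>(2) \<beta>(2) t by blast
    then show "support canonical_model t \<psi>"
      using IH(2)[OF t] \<beta>(1) by blast
  qed
next
  case (Cond \<phi> \<psi>)
  have IH: "support canonical_model t \<phi> \<longleftrightarrow> resolved_in \<phi> (\<Inter>t)"
    "support canonical_model t \<psi> \<longleftrightarrow> resolved_in \<psi> (\<Inter>t)" if "t \<in> canonical_nbhd w" for w t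
  proof -
    have "t \<subseteq> canonical_worlds"
      using that by (simp add: canonical_nbhd_def)
    then show "support canonical_model t \<phi> \<longleftrightarrow> resolved_in \<phi> (\<Inter>t)"
      "support canonical_model t \<psi> \<longleftrightarrow> resolved_in \<psi> (\<Inter>t)"
      by (rule Cond.IH)+
  qed
  have nbhd: "nbhd canonical_model = canonical_nbhd"
    by (simp add: canonical_model_def)
  have "(\<forall>t \<in> canonical_nbhd w. support canonical_model t \<phi> \<longrightarrow> support canonical_model t \<psi>)
    \<longleftrightarrow> \<phi> \<Rrightarrow> \<psi> \<in> w" if w: "w \<in> s" for w
  proof
    assume *: "\<forall>t \<in> canonical_nbhd w. support canonical_model t \<phi> \<longrightarrow> support canonical_model t \<psi>"
    show "\<phi> \<Rrightarrow> \<psi> \<in> w"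
    proof (rule ccontr)
      assume "\<phi> \<Rrightarrow> \<psi> \<notin> w"
      then obtain t where t: "t \<in> canonical_nbhd w"
        "resolved_in \<phi> (\<Inter>t)" "\<not> resolved_in \<psi> (\<Inter>t)"
        by (rule canonical_nbhd_refuting[OF subsetD[OF Cond.prems w]])
      then show False
        using bspec[OF * t(1)] unfolding IH[OF t(1)] by argo
    qed
  next
    assume *: "\<phi> \<Rrightarrow> \<psi> \<in> w"
    show "\<forall>t \<in> canonical_nbhd w. support canonical_model t \<phi> \<longrightarrow> support canonical_model t \<psi>"
    proof
      fix t assume t: "t \<in> canonical_nbhd w"
      then have "resolved_in \<phi> (\<Inter>t) \<longrightarrow> resolved_in \<psi> (\<Inter>t)"
        unfolding canonical_nbhd_def mem_Collect_eq using * by (elim conjE allE) (rule mp)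
      then show "support canonical_model t \<phi> \<longrightarrow> support canonical_model t \<psi>"
        using IH[OF t] by simp
    qed
  qed
  then show ?case
    by (simp add: nbhd)
qed

section \<open>Completeness\<close>

lemma theory_conj_list: "is_theory T \<Longrightarrow> conj_list \<phi>s \<in> T \<longleftrightarrow> set \<phi>s \<subseteq> T"
  by (induction \<phi>s rule: conj_list.induct)
    (simp_all add: theory_conj theory_derivable derivable_refl)

lemma theory_derives: "is_theory {\<psi>. \<Phi> \<^bold>\<turnstile> \<psi>}"
  unfolding is_theory_def mem_Collect_eq
proof (intro conjI allI impI)
  fix \<phi> :: "'a fm" assume "derivable \<phi>"
  then have "derivable (conj_list [] \<^bold>\<rightarrow> \<phi>)"
    by (rule MP[OF _ ImpK])
  then show "\<Phi> \<^bold>\<turnstile> \<phi>"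
    unfolding derives_def by (intro exI[of _ "[]"]) simp
next
  fix \<phi> \<psi> assume "\<Phi> \<^bold>\<turnstile> \<phi>" "\<Phi> \<^bold>\<turnstile> \<phi> \<^bold>\<rightarrow> \<psi>"
  then obtain \<phi>s \<psi>s where s: "set \<phi>s \<subseteq> \<Phi>" "set \<psi>s \<subseteq> \<Phi>"
    and d: "derivable (conj_list \<phi>s \<^bold>\<rightarrow> \<phi>)" "derivable (conj_list \<psi>s \<^bold>\<rightarrow> \<phi> \<^bold>\<rightarrow> \<psi>)"
    unfolding derives_def by blast
  \<comment> \<open>The concatenated list of premises serves both derivations.\<close>
  have "derivable (conj_list (\<phi>s @ \<psi>s) \<^bold>\<rightarrow> \<psi>)"
  proof (rule derivable_impI)
    fix T :: "'a fm set" assume T: "is_theory T" and "conj_list (\<phi>s @ \<psi>s) \<in> T"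
    then have "conj_list \<phi>s \<in> T" "conj_list \<psi>s \<in> T"
      by (simp_all add: theory_conj_list)
    then show "\<psi> \<in> T"
      using d theory_closed[OF T] theory_mp[OF T] by blast
  qed
  then show "\<Phi> \<^bold>\<turnstile> \<psi>"
    using s unfolding derives_def by (intro exI[of _ "\<phi>s @ \<psi>s"]) simp
qed

lemma derives_assumption: "\<phi> \<in> \<Phi> \<Longrightarrow> \<Phi> \<^bold>\<turnstile> \<phi>"
  unfolding derives_def by (intro exI[of _ "[\<phi>]"]) (simp add: derivable_refl)

theorem theorem6p17:
  fixes \<Phi> :: "'p fm set" and \<psi> :: "'p fm"
  assumes "entails TYPE('p fm set) \<Phi> \<psi>"
  shows "\<Phi> \<^bold>\<turnstile> \<psi>"
proof (rule ccontr)
  assume "\<not> \<Phi> \<^bold>\<turnstile> \<psi>"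
  \<comment> \<open>\<open>prime_extension\<close> separates the two sides of an implication, so
    verum serves as antecedent.\<close>
  then have "\<^bold>\<top> \<^bold>\<rightarrow> \<psi> \<notin> {\<psi>. \<Phi> \<^bold>\<turnstile> \<psi>}"
    using theory_mp[OF theory_derives _ theory_derivable[OF theory_derives derivable_refl]] by blast
  then obtain T where T: "prime_theory T" "{\<psi>. \<Phi> \<^bold>\<turnstile> \<psi>} \<subseteq> T" "\<psi> \<notin> T"
    using prime_extension[OF theory_derives] by blast
  have sub: "theory_state T \<subseteq> canonical_worlds"
    by (auto simp: theory_state_def)
  \<comment> \<open>The state of \<open>T\<close> supports exactly the members of \<open>T\<close>,
    so it supports \<Phi> but not \<psi>.\<close>
  have supp: "support canonical_model (theory_state T) \<phi> \<longleftrightarrow> \<phi> \<in> T" for \<phi>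
    using canonical_support[OF sub] resolved_in_theory_state[OF T(1)] by blast
  have "in_model (canonical_model :: ('p fm set, 'p) in_struct)"
    using theory_state_nonempty[OF prime_theoryD[OF T(1)] T(3)] sub
    unfolding in_model_def by (auto simp: canonical_model_def canonical_nbhd_def)
  moreover have "\<forall>\<phi> \<in> \<Phi>. support canonical_model (theory_state T) \<phi>"
    using supp T(2) derives_assumption by blast
  moreover have "theory_state T \<subseteq> worlds canonical_model"
    using sub by (simp add: canonical_model_def)
  \<comment> \<open>Canonical worlds are sets of formulas, so entailment over
    \<open>'p fm set\<close> covers this countermodel.\<close>
  ultimately have "support canonical_model (theory_state T) \<psi>"
    using assms unfolding entails_def by blast
  then show False
    using supp T(3) by blast
qed

end
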